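(* Let $q$ be a power of an odd prime with $q \equiv 3 \pmod 4$. For any multiplicative character $\nu$ on $\mathbb{F}_q$, $$\sum_{j,x \in \mathbb{F}_q^*} \phi\nu^4(j)\,\phi(x)\,\phi(1-x)\,\phi\big(x(j+1)^2 + (j-1)^2\big) = J_2(\nu N M_8, \phi N) + J_2(\nu N M_8^5, \phi N).$$
   Context: All multiplicative characters are complex-valued and are extended to map $0$ to $0$. $\phi$ denotes the quadratic character on $\mathbb{F}_q$, and $\phi\nu^4(j) = (\phi\nu^4)(j)$. $J_2(\alpha,\beta) = \sum_{z \in \mathbb{F}_{q^2}} \alpha(z)\beta(1-z)$ is the Jacobi sum over $\mathbb{F}_{q^2}$, for characters $\alpha,\beta$ on $\mathbb{F}_{q^2}$. For a character $C$ on $\mathbb{F}_q$, $CN$ denotes the character on $\mathbb{F}_{q^2}$ obtained by composing $C$ with the norm $Nz = z\cdot z^q$; thus $\nu N M_8$ is the product of the characters $\nu N$ and $M_8$. $M_8$ is a fixed multiplicative character of order $8$ on $\mathbb{F}_{q^2}$. *)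

theory Defs
  imports
    Complex_Main
    "HOL-Library.Cardinality"
    "HOL-Computational_Algebra.Polynomial"
begin

text \<open>
  A finite field is a type of class \<open>field\<close> and \<open>finite\<close>.  The extension of
  \<open>F_q\<close> by \<open>F_{q^2}\<close> is given by two such types, of \<open>q\<close> and \<open>q^2\<close> elements, and a
  field embedding \<open>\<iota>\<close> of the first into the second.
\<close>

definition field_embedding :: "('a::field \<Rightarrow> 'b::field) \<Rightarrow> bool" where
  "field_embedding \<iota> \<longleftrightarrow>
     \<iota> 1 = 1 \<and> (\<forall>x y. \<iota> (x + y) = \<iota> x + \<iota> y) \<and> (\<forall>x y. \<iota> (x * y) = \<iota> x * \<iota> y)"

definition mult_character :: "('a::field \<Rightarrow> complex) \<Rightarrow> bool" where
  "mult_character \<chi> \<longleftrightarrow> \<chi> 0 = 0 \<and> \<chi> 1 = 1 \<and> (\<forall>x y. \<chi> (x * y) = \<chi> x * \<chi> y)"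

text \<open>
  The identity of the character group is 1 on the nonzero elements, and 0 at 0; hence
  the restriction to \<open>x \<noteq> 0\<close>.
\<close>

definition char_order :: "('a::field \<Rightarrow> complex) \<Rightarrow> nat" where
  "char_order \<chi> = (LEAST n. 0 < n \<and> (\<forall>x. x \<noteq> 0 \<longrightarrow> \<chi> x ^ n = 1))"

definition quadratic_char :: "'a::field \<Rightarrow> complex" where
  "quadratic_char x = (if x = 0 then 0 else if \<exists>y. x = y ^ 2 then 1 else - 1)"

definition jacobi_sum :: "('a::{field,finite} \<Rightarrow> complex) \<Rightarrow> ('a \<Rightarrow> complex) \<Rightarrow> complex" where
  "jacobi_sum \<alpha> \<beta> = (\<Sum>z\<in>UNIV. \<alpha> z * \<beta> (1 - z))"

text \<open>
  The norm \<open>z * z^q\<close> from \<open>F_{q^2}\<close> to \<open>F_q\<close>, as an element of the smaller field: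
  the inverse of \<open>\<iota>\<close> is applied to \<open>z * z^q\<close>, which lies in the range of \<open>\<iota>\<close>
  (lemma \<open>embed_quad_norm\<close>).
\<close>

definition quad_norm :: "('a::{field,finite} \<Rightarrow> 'b::{field,finite}) \<Rightarrow> 'b \<Rightarrow> 'a" where
  "quad_norm \<iota> z = the_inv \<iota> (z * z ^ CARD('a))"

lemma finite_field_power_card:
  fixes x :: "'a::{field,finite}"
  shows "x ^ CARD('a) = x"
proof (cases "x = 0")
  case False
  let ?U = "UNIV - {0::'a}"
  have "bij_betw ((*) x) ?U ?U"
    by (rule bij_betw_byWitness[where f' = "\<lambda>y. y / x"]) (use False in auto)
  then have "(\<Prod>y\<in>?U. y) = (\<Prod>y\<in>?U. x * y)"
    by (rule prod.reindex_bij_betw[symmetric])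
  also have "\<dots> = x ^ card ?U * (\<Prod>y\<in>?U. y)"
    by (simp add: prod.distrib)
  finally have "x ^ card ?U = 1"
    by simp
  then have "x ^ (CARD('a) - 1) = 1"
    by simp
  moreover have "CARD('a) = Suc (CARD('a) - 1)"
    by simp
  ultimately show ?thesis
    by (metis mult.right_neutral power_Suc)
qed simp

lemma field_embedding_inj:
  assumes "field_embedding \<iota>"
  shows "inj \<iota>"
proof (rule injI, rule ccontr)
  fix x y
  assume eq: "\<iota> x = \<iota> y" and ne: "x \<noteq> y"
  have hom: "\<iota> 1 = 1" "\<And>x y. \<iota> (x + y) = \<iota> x + \<iota> y" "\<And>x y. \<iota> (x * y) = \<iota> x * \<iota> y"
    using assms by (auto simp: field_embedding_def)
  have "\<iota> (x - y) + \<iota> y = \<iota> x"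
    by (simp flip: hom(2))
  then have "\<iota> (x - y) = 0"
    using eq by simp
  then have "\<iota> ((x - y) * inverse (x - y)) = 0"
    by (simp only: hom(3) mult_zero_left)
  then show False
    using ne hom(1) by simp
qed

lemma field_embedding_power:
  assumes "field_embedding \<iota>"
  shows "\<iota> (x ^ n) = \<iota> x ^ n"
  using assms by (induction n) (auto simp: field_embedding_def)

lemma range_field_embedding:
  fixes \<iota> :: "'a::{field,finite} \<Rightarrow> 'b::{field,finite}"
  assumes "field_embedding \<iota>"
  shows "range \<iota> = {z. z ^ CARD('a) = z}"
proof -
  let ?q = "CARD('a)"
  define p where "p = monom (1::'b) ?q - monom 1 1"
  have q: "?q > 1"
    using card_mono[of UNIV "{0, 1::'a}"] by simp
  have "coeff p ?q = 1"
    using q by (simp add: p_def)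
  then have nz: "p \<noteq> 0"
    by force
  have deg: "degree p \<le> ?q"
    unfolding p_def using q by (intro degree_diff_le) (auto simp: degree_monom_eq)
  have roots: "{z. poly p z = 0} = {z. z ^ ?q = z}"
    by (simp add: p_def poly_monom)
  have "card {z::'b. z ^ ?q = z} \<le> ?q"
    using card_poly_roots_bound[OF nz] deg by (simp add: roots)
  moreover have "card (range \<iota>) = ?q"
    by (simp add: card_image field_embedding_inj[OF assms])
  moreover have "range \<iota> \<subseteq> {z. z ^ ?q = z}"
    by (auto simp flip: field_embedding_power[OF assms] simp: finite_field_power_card)
  ultimately show ?thesis
    by (intro card_seteq) auto
qed

lemma embed_quad_norm:
  fixes \<iota> :: "'a::{field,finite} \<Rightarrow> 'b::{field,finite}"
  assumes "field_embedding \<iota>" and "CARD('b) = CARD('a) ^ 2"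
  shows "\<iota> (quad_norm \<iota> z) = z * z ^ CARD('a)"
proof -
  have "(z * z ^ CARD('a)) ^ CARD('a) = z * z ^ CARD('a)"
    using finite_field_power_card[of z] assms(2)
    by (simp add: power_mult_distrib power2_eq_square flip: power_mult)
  then have "z * z ^ CARD('a) \<in> range \<iota>"
    by (simp add: range_field_embedding[OF assms(1)])
  then show ?thesis
    unfolding quad_norm_def by (rule f_the_inv_into_f[OF field_embedding_inj[OF assms(1)]])
qed

end

theory Submission
  imports Defs "HOL-Number_Theory.Residues"
begin

text \<open>
  Write \<open>\<phi>\<close> for the quadratic character of \<open>F = F_q\<close>, \<open>N\<close> for the norm from \<open>K = F_{q^2}\<close>, and
  \<open>i\<close> for a square root of \<open>-1\<close> in \<open>K\<close>.  Because \<open>q \<equiv> 3 (mod 4)\<close>, \<open>-1\<close> is a nonsquare in \<open>F\<close>, so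
  \<open>\<phi>(-x) = -\<phi>(x)\<close>, and \<open>K = F(i)\<close> with \<open>N(a + b i) = a^2 + b^2\<close>.

  The quadratic character of \<open>K\<close> is \<open>\<phi> \<circ> N\<close>, and it equals \<open>M8^4\<close>.  The right side is therefore the
  sum of \<open>(1 + \<phi>(N z)) \<nu>(N z) M8(z) \<phi>(N(1 - z))\<close>, in which \<open>1 + \<phi>(N z)\<close> counts the square roots of
  \<open>z\<close>.  Putting \<open>z = w^2\<close> turns it into the sum over \<open>w\<close> in \<open>K\<close> of
  \<open>h(w) = \<nu>(N w)^2 M8(w)^2 \<phi>(N(1 - w^2))\<close> (lemma \<open>jacobi_sums_eq_sum_summand\<close>).

  Conjugation \<open>w \<mapsto> w^q\<close> multiplies \<open>h(w)\<close> by \<open>\<phi>(N w)\<close>, so twice this sum is the sum of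
  \<open>(1 + \<phi>(N w)) h(w)\<close>.  The new factor counts the \<open>j\<close> in \<open>F\<close> with \<open>j^2 = N w\<close>, that is, for
  \<open>w \<noteq> 0\<close>, the ways to write \<open>w = j u\<close> with \<open>N u = 1\<close>; as \<open>h(0) = 0\<close>, twice the right
  side is the sum of \<open>h(j u)\<close> over all \<open>j\<close> and all \<open>u\<close> of norm one (lemmas \<open>summand_conj\<close> and \<open>sum_polar\<close>).

  The elements of norm one are \<open>1\<close> and \<open>u = (a + i)/(a - i)\<close> for \<open>a\<close> in \<open>F\<close>.  There
  \<open>M8(u)^2 = \<phi>(a^2 + 1)\<close>, and \<open>N(1 - j^2 u^2)\<close> is, up to a square factor,
  \<open>(a^2 A + B) (a^2 B + A)\<close> with \<open>A = (1 - j)^2\<close> and \<open>B = (1 + j)^2\<close>.  For fixed \<open>j\<close> this leaves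
  \<open>\<nu>(j)^4\<close> times \<open>\<phi>(A B)\<close> plus the sum of \<open>\<phi>(a^2 + 1) \<phi>(a^2 A + B) \<phi>(a^2 B + A)\<close> over \<open>a\<close> in \<open>F\<close>.

  Put \<open>X = a^2\<close>.  The inversion \<open>X \<mapsto> 1/X\<close> shows that the result is twice the sum of
  \<open>\<phi>(X + 1) \<phi>(X A + B) \<phi>(X B + A)\<close>, and an affine substitution turns this cubic sum into \<open>\<phi>(j)\<close>
  times the inner sum over \<open>x\<close> of the theorem (lemma \<open>sum_over_line_eq_legendre_sum\<close>).  Hence twice
  the right side equals twice the left side.
\<close>

section \<open>Counting square roots in a finite field\<close>

lemma two_neq_zero:
  assumes "odd CARD('a::{field,finite})"
  shows "(2::'a) \<noteq> 0"
proof
  assume "(2::'a) = 0"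
  then have "of_nat 2 = (0::'a)"
    by simp
  then have "CHAR('a) dvd 2"
    by (simp only: of_nat_eq_0_iff_char_dvd)
  moreover have "CHAR('a) dvd CARD('a)"
    by (rule CHAR_dvd_CARD)
  ultimately have "CHAR('a) dvd 1"
    using assms by (metis coprime_left_2_iff_odd not_coprimeI)
  then have "of_nat 1 = (0::'a)"
    by (simp only: of_nat_eq_0_iff_char_dvd)
  then show False
    by simp
qed

lemma quadratic_char_0 [simp]: "quadratic_char 0 = 0"
  by (simp add: quadratic_char_def)

lemma quadratic_char_square: "x \<noteq> 0 \<Longrightarrow> quadratic_char (x ^ 2) = 1"
  by (auto simp: quadratic_char_def)

lemma quadratic_char_1 [simp]: "quadratic_char 1 = 1"
  using quadratic_char_square[of 1] by simp

lemma quadratic_char_mult_self: "x \<noteq> 0 \<Longrightarrow> quadratic_char x * quadratic_char x = 1"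
  by (auto simp: quadratic_char_def)

lemma of_nat_card_square_roots:
  fixes z :: "'a::{field,finite}"
  assumes "odd CARD('a)"
  shows "of_nat (card {w. w ^ 2 = z}) = 1 + quadratic_char z"
proof (cases "\<exists>w. z = w ^ 2")
  case True
  then obtain w where w: "z = w ^ 2" ..
  have eq: "{w. w ^ 2 = z} = {w, - w}"
    by (auto simp: w power2_eq_iff)
  show ?thesis
  proof (cases "z = 0")
    case False
    then have "2 * w \<noteq> 0"
      using two_neq_zero[OF assms] w by simp
    then have "w \<noteq> - w"
      by (simp add: eq_neg_iff_add_eq_0 flip: mult_2)
    then have "card {w. w ^ 2 = z} = 2"
      by (simp add: eq)
    moreover have "quadratic_char z = 1"
      using False w by (auto simp: quadratic_char_def)
    ultimately show ?thesis
      by simp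
  qed (auto simp: eq w)
next
  case False
  then have "{w. w ^ 2 = z} = {}"
    by blast
  moreover have "z \<noteq> 0"
    using False zero_power2 by metis
  ultimately show ?thesis
    using False by (simp add: quadratic_char_def)
qed

text \<open>
  The factor \<open>1 + quadratic_char z\<close> is the number of square roots of \<open>z\<close>; at \<open>z = 0\<close> it is 1, as it must be.
\<close>
lemma sum_over_squares:
  fixes f :: "'a::{field,finite} \<Rightarrow> complex"
  assumes "odd CARD('a)"
  shows "(\<Sum>w\<in>UNIV. f (w ^ 2)) = (\<Sum>z\<in>UNIV. (1 + quadratic_char z) * f z)"
proof -
  have "(\<Sum>w\<in>UNIV. f (w ^ 2)) = (\<Sum>z\<in>UNIV. \<Sum>w | w \<in> UNIV \<and> w ^ 2 = z. f (w ^ 2))"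
    by (rule sum.group[symmetric]) auto
  also have "\<dots> = (\<Sum>z\<in>UNIV. of_nat (card {w. w ^ 2 = z}) * f z)"
    by (rule sum.cong) auto
  finally show ?thesis
    by (simp only: of_nat_card_square_roots[OF assms])
qed

section \<open>Quadratic characters and cubic sums when \<open>-1\<close> is a nonsquare\<close>

lemma sum_nonzero_reindex_inverse:
  fixes f :: "'a::{field,finite} \<Rightarrow> complex"
  shows "(\<Sum>x\<in>UNIV - {0}. f (inverse x)) = (\<Sum>x\<in>UNIV - {0}. f x)"
  by (rule sum.reindex_bij_witness[where i = inverse and j = inverse]) auto

lemma sum_UNIV_split_0:
  fixes f :: "'a::{field,finite} \<Rightarrow> complex"
  shows "(\<Sum>x\<in>UNIV. f x) = f 0 + (\<Sum>x\<in>UNIV - {0}. f x)"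
  by (rule sum.remove) auto

text \<open>
  The two sums below belong to the curves \<open>Y^2 = (X + 1)(A X + B)(B X + A)\<close> and
  \<open>Y^2 = x (1 - x)(B x + A)\<close>.  The first one is adapted to the symmetry \<open>X \<mapsto> 1/X\<close>; the second
  one, with \<open>A = (j - 1)^2\<close> and \<open>B = (j + 1)^2\<close>, is the inner sum of the theorem.
\<close>
definition cubic_sum :: "'a::{field,finite} \<Rightarrow> 'a \<Rightarrow> complex" where
  "cubic_sum A B =
     (\<Sum>X\<in>UNIV. quadratic_char (X + 1) * quadratic_char (X * A + B) * quadratic_char (X * B + A))"

definition legendre_sum :: "'a::{field,finite} \<Rightarrow> 'a \<Rightarrow> complex" where
  "legendre_sum A B =
     (\<Sum>x\<in>UNIV. quadratic_char x * quadratic_char (1 - x) * quadratic_char (x * B + A))"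

lemma cubic_sum_commute: "cubic_sum A B = cubic_sum B A"
  by (simp add: cubic_sum_def mult_ac)

context
  assumes card_mod_4: "CARD('a::{field,finite}) mod 4 = 3"
begin

lemma odd_card: "odd CARD('a)"
  using card_mod_4 by presburger

lemma minus_one_nonsquare: "(y::'a) ^ 2 \<noteq> - 1"
proof
  assume y: "y ^ 2 = - 1"
  \<comment> \<open>As \<open>(q - 1) / 2\<close> is odd, \<open>y ^ 2 = - 1\<close> would give \<open>y = y ^ q = - y\<close>.\<close>
  have "CARD('a) = 2 * (2 * (CARD('a) div 4) + 1) + 1"
    using card_mod_4 by presburger
  then have "y = y ^ (2 * (2 * (CARD('a) div 4) + 1) + 1)"
    using finite_field_power_card[of y] by simp
  also have "\<dots> = - y"
    by (simp only: power_add power_mult y power_one_right power2_minus power_one mult_1 mult_minus_left)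
  finally have "2 * y = 0"
    by (metis add_eq_0_iff mult_2)
  then have "y = 0"
    using two_neq_zero[OF odd_card] by simp
  then show False
    using y by simp
qed

text \<open>
  The exponent \<open>(q + 1)/4\<close> is an integer, and \<open>y = x^((q + 1)/4)\<close> satisfies
  \<open>y^4 = x^(q + 1) = x^2\<close>.  Hence \<open>y^2\<close> is \<open>x\<close> or \<open>-x\<close>.
\<close>
lemma square_or_minus_square:
  obtains y where "(x::'a) = y ^ 2 \<or> x = - (y ^ 2)"
proof -
  have "CARD('a) + 1 = 4 * (CARD('a) div 4 + 1)"
    using card_mod_4 by presburger
  then have "(x ^ (CARD('a) div 4 + 1)) ^ 4 = x ^ (CARD('a) + 1)"
    by (simp only: power_mult[symmetric] mult.commute)
  also have "\<dots> = x ^ 2"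
    using finite_field_power_card[of x] by (simp add: power2_eq_square)
  finally have "((x ^ (CARD('a) div 4 + 1)) ^ 2) ^ 2 = x ^ 2"
    by (simp flip: power_mult)
  then have "(x ^ (CARD('a) div 4 + 1)) ^ 2 = x \<or> (x ^ (CARD('a) div 4 + 1)) ^ 2 = - x"
    by (simp only: power2_eq_iff)
  then show ?thesis
    using that[of "x ^ (CARD('a) div 4 + 1)"] by (metis minus_minus)
qed

lemma quadratic_char_minus: "quadratic_char (- x :: 'a) = - quadratic_char x"
proof -
  obtain y where y: "x = y ^ 2 \<or> x = - (y ^ 2)"
    by (rule square_or_minus_square)
  \<comment> \<open>A square root of \<open>- (y ^ 2)\<close>, divided by \<open>y\<close>, would be a square root of \<open>- 1\<close>.\<close>
  have *: "quadratic_char (- (y ^ 2)) = - 1" if "y \<noteq> 0"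
  proof -
    have "- (y ^ 2) \<noteq> w ^ 2" for w
    proof
      assume "- (y ^ 2) = w ^ 2"
      then have "(w / y) ^ 2 = - 1"
        using that by (simp add: power_divide divide_eq_eq)
      then show False
        using minus_one_nonsquare by blast
    qed
    then show ?thesis
      using that by (auto simp: quadratic_char_def)
  qed
  show ?thesis
    using y * quadratic_char_square[of y] by (cases "y = 0") auto
qed

lemma quadratic_char_mult:
  "quadratic_char (x * y :: 'a) = quadratic_char x * quadratic_char y"
proof -
  obtain a where a: "x = a ^ 2 \<or> x = - (a ^ 2)"
    by (rule square_or_minus_square)
  obtain b where b: "y = b ^ 2 \<or> y = - (b ^ 2)"
    by (rule square_or_minus_square)
  have "quadratic_char (a ^ 2 * b ^ 2) = quadratic_char (a ^ 2) * quadratic_char (b ^ 2)"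
    by (cases "a = 0 \<or> b = 0")
       (auto simp: quadratic_char_square simp flip: power_mult_distrib)
  then show ?thesis
    using a b by (auto simp: quadratic_char_minus)
qed

lemma quadratic_char_square_mult:
  "c \<noteq> 0 \<Longrightarrow> quadratic_char (c ^ 2 * x :: 'a) = quadratic_char x"
  by (simp add: quadratic_char_mult quadratic_char_square)

lemma quadratic_char_inverse: "quadratic_char (inverse x :: 'a) = quadratic_char x"
proof (cases "x = 0")
  case False
  then have "inverse x = inverse x ^ 2 * x"
    by (simp add: power2_eq_square)
  then show ?thesis
    using False quadratic_char_square_mult[of "inverse x" x] by simp
qed simp

text \<open>
  The substitution \<open>x \<mapsto> 1/x\<close> reverses a linear factor, at the price of one factor
  \<open>quadratic_char x\<close>.
\<close>
lemma quadratic_char_inverse_affine: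
  assumes "x \<noteq> 0"
  shows "quadratic_char (inverse x * c + d :: 'a) = quadratic_char x * quadratic_char (x * d + c)"
proof -
  have "inverse x * c + d = inverse x * (x * d + c)"
    using assms by (simp add: field_simps)
  then show ?thesis
    by (simp only: quadratic_char_mult quadratic_char_inverse)
qed

text \<open>
  Substitute \<open>1/x\<close> for \<open>x\<close>.  The sign is that of \<open>1 - 1/x = -(1 - x)/x\<close>, since \<open>-1\<close> is a
  nonsquare.
\<close>
lemma legendre_sum_swap: "legendre_sum (B::'a) A = - legendre_sum A B"
proof -
  let ?f = "\<lambda>A B x. quadratic_char x * quadratic_char (1 - x) * quadratic_char (x * B + A :: 'a)"
  have "?f B A (inverse x) = - ?f A B x" if "x \<noteq> 0" for x
  proof -
    have "quadratic_char (1 - inverse x) = quadratic_char (inverse x * (-1) + 1)"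
      by simp
    also have "\<dots> = quadratic_char x * quadratic_char (- (1 - x))"
      by (subst quadratic_char_inverse_affine[OF that]) simp
    also have "\<dots> = - (quadratic_char x * quadratic_char (1 - x))"
      by (simp only: quadratic_char_minus) simp
    finally have "?f B A (inverse x) = quadratic_char x * (- (quadratic_char x * quadratic_char (1 - x)))
        * (quadratic_char x * quadratic_char (x * B + A))"
      by (simp only: quadratic_char_inverse quadratic_char_inverse_affine[OF that])
    also have "\<dots> = - (quadratic_char x * quadratic_char x) * ?f A B x"
      by (simp add: mult_ac)
    finally show ?thesis
      using quadratic_char_mult_self[OF that] by simp
  qed
  then have "(\<Sum>x\<in>UNIV - {0}. ?f B A (inverse x)) = (\<Sum>x\<in>UNIV - {0}. - ?f A B x)"
    by (intro sum.cong) auto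
  then have "(\<Sum>x\<in>UNIV - {0}. ?f B A x) = - (\<Sum>x\<in>UNIV - {0}. ?f A B x)"
    by (simp only: sum_nonzero_reindex_inverse[of "?f B A"] sum_negf)
  then show ?thesis
    by (simp add: legendre_sum_def sum_UNIV_split_0)
qed

text \<open>
  Substitute \<open>1/X\<close> for \<open>X\<close> in \<open>cubic_sum\<close>: the cubic is self-reciprocal of odd degree, so its
  character acquires the factor \<open>quadratic_char X\<close>.  The subtracted term is the one at \<open>X = 0\<close>, which
  only the untwisted sum contains.
\<close>
lemma twisted_cubic_sum:
  "(\<Sum>X\<in>UNIV. quadratic_char X *
      (quadratic_char (X + 1) * quadratic_char (X * A + B) * quadratic_char (X * B + A)))
   = cubic_sum A B - quadratic_char (A * B :: 'a)"
proof -
  let ?f = "\<lambda>X. quadratic_char (X + 1) * quadratic_char (X * A + B) * quadratic_char (X * B + A :: 'a)"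
  have "?f (inverse X) = quadratic_char X * ?f X" if "X \<noteq> 0" for X
  proof -
    have "?f (inverse X) = quadratic_char (inverse X * 1 + 1)
        * quadratic_char (inverse X * A + B) * quadratic_char (inverse X * B + A)"
      by simp
    also have "\<dots> = (quadratic_char X * quadratic_char X) * (quadratic_char X * ?f X)"
      by (simp only: quadratic_char_inverse_affine[OF that]) (simp add: mult_ac)
    finally show ?thesis
      using quadratic_char_mult_self[OF that] by simp
  qed
  then have "(\<Sum>X\<in>UNIV - {0}. ?f (inverse X)) = (\<Sum>X\<in>UNIV - {0}. quadratic_char X * ?f X)"
    by (intro sum.cong) auto
  then have "(\<Sum>X\<in>UNIV - {0}. quadratic_char X * ?f X) = (\<Sum>X\<in>UNIV - {0}. ?f X)"
    by (simp only: sum_nonzero_reindex_inverse[of ?f])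
  then show ?thesis
    by (simp add: cubic_sum_def sum_UNIV_split_0 quadratic_char_mult)
qed

text \<open>
  With \<open>d = B - A\<close>, the substitution \<open>X = d x / B - 1\<close> sends the three linear factors to
  \<open>d x / B\<close>, \<open>d (A x + B) / B\<close> and \<open>-d (1 - x)\<close>; the factors \<open>B\<close> drop out because \<open>B\<close> is a
  square, and \<open>-1\<close> is absorbed by \<open>legendre_sum_swap\<close>.
\<close>
lemma cubic_sum_eq_legendre_sum:
  assumes "(A::'a) \<noteq> b ^ 2" and "b \<noteq> 0"
  shows "cubic_sum A (b ^ 2) = quadratic_char (b ^ 2 - A) * legendre_sum A (b ^ 2)"
proof -
  define B where "B = b ^ 2"
  define d where "d = B - A"
  have d: "d \<noteq> 0" and B: "B \<noteq> 0" and qB: "quadratic_char B = 1"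
    using assms by (auto simp: d_def B_def quadratic_char_square)
  let ?f = "\<lambda>X. quadratic_char (X + 1) * quadratic_char (X * A + B) * quadratic_char (X * B + A)"
  let ?s = "\<lambda>x. d * x * inverse B - 1"
  have "cubic_sum A B = (\<Sum>x\<in>UNIV. ?f (?s x))"
    unfolding cubic_sum_def
    by (rule sum.reindex_bij_witness[where i = ?s and j = "\<lambda>X. (X + 1) * B / d"])
       (use d B in \<open>simp_all add: mult.assoc\<close>)
  also have "\<dots> = (\<Sum>x\<in>UNIV. - quadratic_char d *
      (quadratic_char x * quadratic_char (1 - x) * quadratic_char (x * A + B)))"
  proof (rule sum.cong)
    fix x
    have "?s x + 1 = d * x * inverse B" and "?s x * A + B = d * (x * A + B) * inverse B"
      and "?s x * B + A = d * (- (1 - x))"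
      using B by (simp_all add: d_def field_simps)
    then have "?f (?s x) = quadratic_char (d * x * inverse B)
        * quadratic_char (d * (x * A + B) * inverse B) * quadratic_char (d * (- (1 - x)))"
      by (simp only:)
    also have "\<dots> = (quadratic_char d * quadratic_char d) * - quadratic_char d *
      (quadratic_char x * quadratic_char (1 - x) * quadratic_char (x * A + B))"
      by (simp only: quadratic_char_mult quadratic_char_minus quadratic_char_inverse qB) simp
    finally show "?f (?s x) = - quadratic_char d *
      (quadratic_char x * quadratic_char (1 - x) * quadratic_char (x * A + B))"
      by (simp add: quadratic_char_mult_self[OF d])
  qed simp
  also have "\<dots> = - quadratic_char d * legendre_sum B A"
    by (simp only: legendre_sum_def sum_distrib_left)
  finally show ?thesis
    using legendre_sum_swap[where A = A and B = B] by (simp add: d_def B_def)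
qed

text \<open>
  The substitution of \<open>cubic_sum_eq_legendre_sum\<close> divides by \<open>b\<close>.  If \<open>b = 0\<close>, then \<open>a \<noteq> 0\<close> and
  the roles of \<open>a\<close> and \<open>b\<close> can be exchanged: the cubic sum is symmetric, and both factors on the
  right change sign.
\<close>
lemma cubic_sum_squares:
  assumes "(a::'a) ^ 2 \<noteq> b ^ 2"
  shows "cubic_sum (a ^ 2) (b ^ 2) = quadratic_char (b ^ 2 - a ^ 2) * legendre_sum (a ^ 2) (b ^ 2)"
proof (cases "b = 0")
  case False
  then show ?thesis
    using cubic_sum_eq_legendre_sum assms by blast
next
  case True
  then have "a \<noteq> 0"
    using assms by auto
  then have "cubic_sum (b ^ 2) (a ^ 2)
      = quadratic_char (- (b ^ 2 - a ^ 2)) * - legendre_sum (a ^ 2) (b ^ 2)"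
    using cubic_sum_eq_legendre_sum[of "b ^ 2" a] assms legendre_sum_swap[of "b ^ 2" "a ^ 2"]
    by simp
  then show ?thesis
    by (simp only: cubic_sum_commute quadratic_char_minus) simp
qed

text \<open>
  The left side runs over the projective line of norm-one elements of the quadratic extension; the
  isolated term is the point at infinity.  After \<open>X = a^2\<close> it is the sum of the cubic sum and of its
  twist, and the term at infinity is exactly what makes these two equal.  Finally
  \<open>(1 + j)^2 - (1 - j)^2 = 2^2 j\<close>, which is where \<open>quadratic_char j\<close> comes from.
\<close>
lemma sum_over_line_eq_legendre_sum:
  assumes "(j::'a) \<noteq> 0"
  shows "quadratic_char ((1 - j) ^ 2 * (1 + j) ^ 2) +
      (\<Sum>a\<in>UNIV. quadratic_char (a ^ 2 + 1) * quadratic_char (a ^ 2 * (1 - j) ^ 2 + (1 + j) ^ 2)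
        * quadratic_char (a ^ 2 * (1 + j) ^ 2 + (1 - j) ^ 2))
    = 2 * quadratic_char j * legendre_sum ((1 - j) ^ 2) ((1 + j) ^ 2)"
proof -
  let ?A = "(1 - j) ^ 2" and ?B = "(1 + j) ^ 2"
  let ?f = "\<lambda>X. quadratic_char (X + 1) * quadratic_char (X * ?A + ?B) * quadratic_char (X * ?B + ?A)"
  have "(\<Sum>a\<in>UNIV. ?f (a ^ 2)) = cubic_sum ?A ?B + (cubic_sum ?A ?B - quadratic_char (?A * ?B))"
    unfolding sum_over_squares[OF odd_card, of ?f] twisted_cubic_sum[symmetric]
    by (simp add: cubic_sum_def distrib_right sum.distrib)
  moreover have "cubic_sum ?A ?B = quadratic_char j * legendre_sum ?A ?B"
  proof -
    have d: "?B - ?A = 2 ^ 2 * j"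
      by (simp add: power2_eq_square algebra_simps)
    have "2 ^ 2 * j \<noteq> 0"
      using assms two_neq_zero[OF odd_card] by (metis mult_eq_0_iff power_not_zero)
    then have "?A \<noteq> ?B"
      using d by auto
    then show ?thesis
      using quadratic_char_square_mult[OF two_neq_zero[OF odd_card], of j]
        cubic_sum_squares[of "1 - j" "1 + j"] by (simp only: d) simp
  qed
  ultimately show ?thesis
    by simp
qed

end

section \<open>The order of a multiplicative character\<close>

lemma mult_character_power:
  "mult_character \<chi> \<Longrightarrow> n > 0 \<or> x \<noteq> 0 \<Longrightarrow> \<chi> (x ^ n) = \<chi> x ^ n"
  by (induction n) (auto simp: mult_character_def)

text \<open>
  The exponent \<open>card - 1\<close> annihilates every character, so the minimum that defines the order is
  attained.
\<close>
lemma char_order_power: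
  fixes \<chi> :: "'a::{field,finite} \<Rightarrow> complex"
  assumes "mult_character \<chi>"
  shows "x \<noteq> 0 \<Longrightarrow> \<chi> x ^ char_order \<chi> = 1"
    and "0 < n \<Longrightarrow> n < char_order \<chi> \<Longrightarrow> \<exists>x. x \<noteq> 0 \<and> \<chi> x ^ n \<noteq> 1"
proof -
  let ?P = "\<lambda>n. 0 < n \<and> (\<forall>x. x \<noteq> 0 \<longrightarrow> \<chi> x ^ n = 1)"
  have "CARD('a) > 1"
    using card_mono[of UNIV "{0, 1::'a}"] by simp
  moreover have "\<chi> x ^ (CARD('a) - 1) = 1" if "x \<noteq> 0" for x
  proof -
    have "x ^ (CARD('a) - 1) * x = 1 * x"
      using finite_field_power_card[of x] by (simp flip: power_Suc2)
    then have "x ^ (CARD('a) - 1) = 1"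
      using that by (metis mult_right_cancel)
    then show ?thesis
      using mult_character_power[OF assms, of "CARD('a) - 1" x] that assms
      by (simp add: mult_character_def)
  qed
  ultimately have "?P (CARD('a) - 1)"
    by simp
  then have "?P (LEAST n. ?P n)"
    by (rule LeastI)
  then show "x \<noteq> 0 \<Longrightarrow> \<chi> x ^ char_order \<chi> = 1"
    unfolding char_order_def by simp
  show "0 < n \<Longrightarrow> n < char_order \<chi> \<Longrightarrow> \<exists>x. x \<noteq> 0 \<and> \<chi> x ^ n \<noteq> 1"
    unfolding char_order_def using not_less_Least by blast
qed

section \<open>The quadratic extension\<close>

locale quadratic_extension =
  fixes \<iota> :: "'a::{field,finite} \<Rightarrow> 'b::{field,finite}" and p k :: nat
  assumes prime_p: "prime p" and card_base_power: "CARD('a) = p ^ k"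
    and card_base_mod_4: "CARD('a) mod 4 = 3" and card_ext: "CARD('b) = CARD('a) ^ 2"
    and embedding: "field_embedding \<iota>"
begin

abbreviation \<phi> :: "'a \<Rightarrow> complex" where "\<phi> \<equiv> quadratic_char"
abbreviation N :: "'b \<Rightarrow> 'a" where "N \<equiv> quad_norm \<iota>"

definition conjugate :: "'b \<Rightarrow> 'b" where "conjugate z = z ^ CARD('a)"

lemmas phi_mult = quadratic_char_mult[OF card_base_mod_4]
lemmas phi_inverse = quadratic_char_inverse[OF card_base_mod_4]

lemma odd_card_ext: "odd CARD('b)"
  using odd_card[OF card_base_mod_4] card_ext by simp

lemma emb_1 [simp]: "\<iota> 1 = 1"
  and emb_add: "\<iota> (x + y) = \<iota> x + \<iota> y"
  and emb_mult: "\<iota> (x * y) = \<iota> x * \<iota> y"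
  using embedding by (auto simp: field_embedding_def)

lemma emb_power: "\<iota> (x ^ n) = \<iota> x ^ n"
  by (rule field_embedding_power[OF embedding])

lemma emb_eq_iff [simp]: "\<iota> x = \<iota> y \<longleftrightarrow> x = y"
  using field_embedding_inj[OF embedding] by (auto dest: injD)

lemma emb_0 [simp]: "\<iota> 0 = 0"
  using emb_add[of 0 0] by (simp only: add_0 add_cancel_right_right)

lemma emb_eq_0_iff [simp]: "\<iota> x = 0 \<longleftrightarrow> x = 0"
  using emb_eq_iff[of x 0] by simp

lemma emb_minus: "\<iota> (- x) = - \<iota> x"
  using emb_add[of x "- x"] by (simp add: eq_neg_iff_add_eq_0 add.commute)

lemma emb_diff: "\<iota> (x - y) = \<iota> x - \<iota> y"
  using emb_add[of x "- y"] by (simp add: emb_minus)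

lemma CHAR_ext: "CHAR('b) = p"
proof -
  have "prime CHAR('b)"
    by (rule prime_CHAR_semidom) (rule finite_imp_CHAR_pos, simp)
  moreover have "CHAR('b) dvd p ^ (k * 2)"
    using CHAR_dvd_CARD[where 'a = 'b] card_ext card_base_power by (simp add: power_mult)
  ultimately show ?thesis
    using prime_p by (metis prime_dvd_power primes_dvd_imp_eq)
qed

lemma conj_add: "conjugate (x + y) = conjugate x + conjugate y"
  unfolding conjugate_def by (rule freshmans_dream') (use CHAR_ext prime_p card_base_power in auto)

lemma conj_mult: "conjugate (x * y) = conjugate x * conjugate y"
  by (simp add: conjugate_def power_mult_distrib)

lemma conj_divide: "conjugate (x / y) = conjugate x / conjugate y"
  by (simp add: conjugate_def power_divide)

lemma conj_0 [simp]: "conjugate 0 = 0"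
  by (simp add: conjugate_def)

lemma conj_1 [simp]: "conjugate 1 = 1"
  by (simp add: conjugate_def)

lemma conj_diff: "conjugate (x - y) = conjugate x - conjugate y"
  using conj_add[of "x - y" y] by simp

lemma conj_emb [simp]: "conjugate (\<iota> x) = \<iota> x"
  by (simp add: conjugate_def finite_field_power_card flip: emb_power)

lemma conj_conj [simp]: "conjugate (conjugate z) = z"
  using finite_field_power_card[of z] card_ext
  by (simp add: conjugate_def power2_eq_square flip: power_mult)

lemma conj_eq_0_iff [simp]: "conjugate z = 0 \<longleftrightarrow> z = 0"
  by (simp add: conjugate_def)

lemma conj_fixedE:
  assumes "conjugate z = z"
  obtains a where "z = \<iota> a"
  using assms range_field_embedding[OF embedding] by (auto simp: conjugate_def)

lemma two_ext: "(2::'b) \<noteq> 0"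
  by (rule two_neq_zero[OF odd_card_ext])

lemma minus_eq_self_iff: "- w = w \<longleftrightarrow> w = (0::'b)"
proof -
  have "- w = w \<longleftrightarrow> 2 * w = 0"
    by (simp only: mult_2 neg_eq_iff_add_eq_0)
  then show ?thesis
    using two_ext by simp
qed

text \<open>
  For \<open>z\<close> outside the base field, \<open>w = z - conjugate z\<close> is not fixed by conjugation, but \<open>w^2\<close>
  is.  So \<open>w^2\<close> is a nonsquare of the base field, hence \<open>- (y^2)\<close> for some \<open>y\<close>, and \<open>w / y\<close> is
  the required element.
\<close>
lemma ex_imaginary_unit: "\<exists>i::'b. i ^ 2 = - 1"
proof -
  have "CARD('a) > 1"
    using card_mono[of UNIV "{0, 1::'a}"] by simp
  then have "CARD('a) < CARD('b)"
    by (simp add: card_ext power2_eq_square)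
  then have "range \<iota> \<noteq> UNIV"
    using card_image_le[of UNIV \<iota>] by auto
  then obtain z where z: "conjugate z \<noteq> z"
    using conj_fixedE by blast
  define w where "w = z - conjugate z"
  have w: "conjugate w = - w" "w \<noteq> 0"
    using z by (auto simp: w_def conj_diff)
  then have "conjugate (w ^ 2) = w ^ 2"
    by (simp add: power2_eq_square conj_mult)
  then obtain a where a: "w ^ 2 = \<iota> a"
    by (rule conj_fixedE)
  obtain y where y: "a = y ^ 2 \<or> a = - (y ^ 2)"
    by (rule square_or_minus_square[OF card_base_mod_4])
  have "a \<noteq> y ^ 2"
  proof
    assume "a = y ^ 2"
    then have "w = \<iota> y \<or> w = \<iota> (- y)"
      using a by (auto simp: emb_power power2_eq_iff emb_minus)
    then have "conjugate w = w"
      by auto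
    then show False
      using w minus_eq_self_iff by auto
  qed
  then have "w ^ 2 = - (\<iota> y ^ 2)"
    using y a by (simp add: emb_minus emb_power)
  moreover from this have "\<iota> y \<noteq> 0"
    using w by auto
  ultimately have "(w / \<iota> y) ^ 2 = - 1"
    by (simp add: power_divide divide_eq_eq)
  then show ?thesis
    by blast
qed

definition im :: 'b where "im = (SOME i. i ^ 2 = - 1)"

lemma im_square: "im ^ 2 = - 1"
  unfolding im_def by (rule someI_ex[OF ex_imaginary_unit])

lemma im_mult_im: "im * im = - 1"
  using im_square by (simp add: power2_eq_square)

lemma im_nonzero: "im \<noteq> 0"
  using im_square by auto

text \<open>
  As \<open>(q - 1)/2\<close> is odd, \<open>im^q = im (im^2)^((q - 1)/2) = -im\<close>.
\<close>
lemma conj_im: "conjugate im = - im"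
proof -
  have "CARD('a) = 2 * (2 * (CARD('a) div 4) + 1) + 1"
    using card_base_mod_4 by presburger
  then have "conjugate im = im ^ (2 * (2 * (CARD('a) div 4) + 1) + 1)"
    unfolding conjugate_def by simp
  also have "\<dots> = - im"
    by (simp only: power_add power_mult im_square power_one_right power2_minus power_one mult_1
        mult_minus_left)
  finally show ?thesis .
qed

lemma emb_plus_im_nonzero: "\<iota> a + im \<noteq> 0" and emb_minus_im_nonzero: "\<iota> a - im \<noteq> 0"
proof -
  have "conjugate (\<iota> b) \<noteq> im" for b
    using conj_im minus_eq_self_iff[of im] im_nonzero by (metis conj_emb)
  then show "\<iota> a - im \<noteq> 0" and "\<iota> a + im \<noteq> 0"
    by (metis conj_emb eq_iff_diff_eq_0, metis conj_emb emb_minus neg_eq_iff_add_eq_0)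
qed

lemma emb_N: "\<iota> (N z) = z * conjugate z"
  unfolding conjugate_def by (rule embed_quad_norm[OF embedding card_ext])

lemma N_eqI: "\<iota> a = z * conjugate z \<Longrightarrow> N z = a"
  by (metis emb_N emb_eq_iff)

lemma N_mult: "N (x * y) = N x * N y"
  by (rule N_eqI) (simp add: emb_mult emb_N conj_mult)

lemma N_power2: "N (x ^ 2) = N x ^ 2"
  by (simp add: power2_eq_square N_mult)

lemma N_0 [simp]: "N 0 = 0"
  by (rule N_eqI) simp

lemma N_1 [simp]: "N 1 = 1"
  by (rule N_eqI) simp

lemma N_emb: "N (\<iota> a) = a ^ 2"
  by (rule N_eqI) (simp add: emb_mult power2_eq_square)

lemma N_conj: "N (conjugate z) = N z"
  by (rule N_eqI) (simp add: emb_N mult.commute)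

lemma N_eq_0_iff [simp]: "N z = 0 \<longleftrightarrow> z = 0"
  by (metis N_0 conj_eq_0_iff emb_0 emb_N mult_eq_0_iff)

lemma N_divide: "N (x / y) = N x / N y"
proof (cases "y = 0")
  case False
  then have "N (x / y) * N y = N x"
    by (simp flip: N_mult)
  then show ?thesis
    using False by (simp add: eq_divide_eq)
qed simp

text \<open>
  The elements \<open>1\<close> and \<open>im\<close> give coordinates over the base field in which the norm is a sum of two squares.
\<close>
lemma N_cartesian: "N (\<iota> a + \<iota> b * im) = a ^ 2 + b ^ 2"
proof (rule N_eqI)
  have "(\<iota> a + \<iota> b * im) * conjugate (\<iota> a + \<iota> b * im) = \<iota> a * \<iota> a - \<iota> b * \<iota> b * (im * im)"
    by (simp add: conj_add conj_mult conj_im algebra_simps)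
  then show "\<iota> (a ^ 2 + b ^ 2) = (\<iota> a + \<iota> b * im) * conjugate (\<iota> a + \<iota> b * im)"
    by (simp add: im_mult_im emb_add emb_mult power2_eq_square)
qed

lemma N_emb_plus_im: "N (\<iota> a + im) = a ^ 2 + 1"
  using N_cartesian[of a 1] by simp

lemma N_emb_minus_im: "N (\<iota> a - im) = a ^ 2 + 1"
  using N_cartesian[of a "- 1"] by (simp add: emb_minus)

lemma square_plus_1_nonzero: "a ^ 2 + 1 \<noteq> (0::'a)"
  using minus_one_nonsquare[OF card_base_mod_4, of a] by (metis eq_neg_iff_add_eq_0)

section \<open>Elements of norm one\<close>

text \<open>
  The rational parametrization of the unit circle \<open>N u = 1\<close> by lines through the point \<open>1\<close>, which
  it omits.  It makes Hilbert's Theorem 90 explicit: \<open>unit_param a\<close> is the quotient of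
  \<open>a + im\<close> by its conjugate.
\<close>
definition unit_param :: "'a \<Rightarrow> 'b" where
  "unit_param a = (\<iota> a + im) / (\<iota> a - im)"

text \<open>
  This form shows \<open>unit_param a\<close> as a square times an element of the base field, so that
  characters can be evaluated at it.
\<close>
lemma unit_param_eq: "unit_param a = (\<iota> a + im) ^ 2 / \<iota> (a ^ 2 + 1)"
proof -
  have "\<iota> (a ^ 2 + 1) = (\<iota> a + im) * (\<iota> a - im)"
    using N_emb_plus_im[of a] emb_N[of "\<iota> a + im"] by (simp add: conj_add conj_im)
  then show ?thesis
    using emb_plus_im_nonzero[of a] by (simp add: unit_param_def power2_eq_square)
qed

lemma inj_unit_param: "inj unit_param"
proof (rule injI)
  fix a b
  assume "unit_param a = unit_param b"
  then have "(\<iota> a + im) * (\<iota> b - im) = (\<iota> b + im) * (\<iota> a - im)"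
    using emb_minus_im_nonzero by (simp add: unit_param_def frac_eq_eq)
  then have "2 * (im * (\<iota> b - \<iota> a)) = 0"
    by (simp add: algebra_simps)
  then show "a = b"
    using two_ext im_nonzero by simp
qed

text \<open>
  The preimage of \<open>u\<close> is \<open>r = im (u + 1)/(u - 1)\<close>.  It is fixed by conjugation, which inverts
  \<open>u\<close> and negates \<open>im\<close>, so it lies in the base field.
\<close>
lemma range_unit_param: "range unit_param = {u. N u = 1} - {1}"
proof (intro equalityI subsetI)
  fix u
  assume "u \<in> range unit_param"
  then obtain a where u: "u = unit_param a"
    by auto
  then have "N u = 1"
    using square_plus_1_nonzero[of a] by (simp add: unit_param_def N_divide N_emb_plus_im N_emb_minus_im)
  moreover have "u \<noteq> 1"
  proof
    assume "u = 1"
    then have "\<iota> a + im = \<iota> a - im"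
      using emb_minus_im_nonzero[of a] u by (simp add: unit_param_def)
    then have "- im = im"
      by simp
    then show False
      using minus_eq_self_iff im_nonzero by blast
  qed
  ultimately show "u \<in> {u. N u = 1} - {1}"
    by simp
next
  fix u
  assume "u \<in> {u. N u = 1} - {1}"
  then have u: "u * conjugate u = 1" "u \<noteq> 1"
    using emb_N[of u] by auto
  have u0: "u \<noteq> 0" and u1: "u - 1 \<noteq> 0" "1 - u \<noteq> 0"
    using u by auto
  have cu: "conjugate u = 1 / u"
    using u u0 by (simp add: eq_divide_eq mult.commute)
  define r where "r = im * (u + 1) / (u - 1)"
  have "conjugate r = - im * (1 / u + 1) / (1 / u - 1)"
    by (simp add: r_def conj_divide conj_mult conj_add conj_diff conj_im cu)
  also have "1 / u + 1 = (u + 1) / u"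
    using u0 by (simp add: field_simps)
  also have "1 / u - 1 = (1 - u) / u"
    using u0 by (simp add: field_simps)
  also have "- im * ((u + 1) / u) / ((1 - u) / u) = - im * (u + 1) / (1 - u)"
    using u0 by simp
  also have "\<dots> = r"
    using u1 by (simp add: r_def frac_eq_eq algebra_simps)
  finally obtain a where a: "r = \<iota> a"
    by (rule conj_fixedE)
  have "r + im = 2 * im * u / (u - 1)" and "r - im = 2 * im / (u - 1)"
    using u1 by (simp_all add: r_def field_simps)
  then have "unit_param a = u"
    using u1 two_ext im_nonzero by (simp add: unit_param_def flip: a)
  then show "u \<in> range unit_param"
    by auto
qed

lemma sum_norm_one:
  fixes h :: "'b \<Rightarrow> complex"
  shows "(\<Sum>u | N u = 1. h u) = h 1 + (\<Sum>a\<in>UNIV. h (unit_param a))"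
proof -
  have "(\<Sum>u | N u = 1. h u) = h 1 + (\<Sum>u\<in>{u. N u = 1} - {1}. h u)"
    by (rule sum.remove) auto
  also have "(\<Sum>u\<in>{u. N u = 1} - {1}. h u) = (\<Sum>a\<in>UNIV. h (unit_param a))"
    by (simp add: sum.reindex[OF inj_unit_param] flip: range_unit_param)
  finally show ?thesis .
qed

section \<open>The quadratic character of the extension\<close>

lemma emb_square: "\<exists>s. \<iota> c = s ^ 2"
proof -
  obtain y where "c = y ^ 2 \<or> c = - (y ^ 2)"
    by (rule square_or_minus_square[OF card_base_mod_4])
  then have "\<iota> c = \<iota> y ^ 2 \<or> \<iota> c = (im * \<iota> y) ^ 2"
    by (auto simp: emb_power emb_minus power_mult_distrib im_square)
  then show ?thesis
    by blast
qed

lemma norm_one_square: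
  assumes "N u = 1"
  shows "\<exists>s. u = s ^ 2"
proof (cases "u = 1")
  case True
  then show ?thesis
    by (metis power_one)
next
  case False
  then have "u \<in> range unit_param"
    using assms by (simp add: range_unit_param)
  then obtain a where u: "u = (\<iota> a + im) ^ 2 / \<iota> (a ^ 2 + 1)"
    by (auto simp: unit_param_eq)
  obtain s where "\<iota> (a ^ 2 + 1) = s ^ 2"
    using emb_square by blast
  then have "u = ((\<iota> a + im) / s) ^ 2"
    by (simp add: u power_divide)
  then show ?thesis ..
qed

text \<open>
  Dividing \<open>z\<close> by a square root of its norm gives an element of norm one, and both elements of norm
  one and elements of the base field are squares in the extension.
\<close>
lemma square_if_norm_square:
  assumes "N z = c ^ 2"
  shows "\<exists>s. z = s ^ 2"
proof (cases "z = 0")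
  case False
  then have c: "c \<noteq> 0"
    using assms by (metis N_eq_0_iff zero_power2)
  then have "N (z / \<iota> c) = 1"
    using assms by (simp add: N_divide N_emb)
  then obtain s where "z / \<iota> c = s ^ 2"
    using norm_one_square by blast
  moreover obtain t where "\<iota> c = t ^ 2"
    using emb_square by blast
  moreover have "z = z / \<iota> c * \<iota> c"
    using c by simp
  ultimately have "z = (s * t) ^ 2"
    by (simp only: power_mult_distrib)
  then show ?thesis ..
qed (metis zero_power2)

lemma quadratic_char_ext: "quadratic_char z = \<phi> (N z)"
proof -
  have "(\<exists>s. z = s ^ 2) \<longleftrightarrow> (\<exists>c. N z = c ^ 2)"
    using square_if_norm_square N_power2 by blast
  then show ?thesis
    by (simp add: quadratic_char_def)
qed

section \<open>Polar coordinates\<close>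

lemma sum_over_norm_square:
  fixes h :: "'b \<Rightarrow> complex"
  assumes "h 0 = 0"
  shows "(\<Sum>u | N u = 1. h (\<iota> j * u)) = (\<Sum>w | N w = j ^ 2. h w)"
proof (cases "j = 0")
  case True
  then show ?thesis
    using assms by simp
next
  case False
  then show ?thesis
    by (intro sum.reindex_bij_witness[where i = "\<lambda>w. w / \<iota> j" and j = "\<lambda>u. \<iota> j * u"])
       (auto simp: N_mult N_divide N_emb)
qed

text \<open>
  The fibre of \<open>(j, u) \<mapsto> j u\<close> over \<open>w \<noteq> 0\<close> corresponds to the square roots \<open>j\<close> of \<open>N w\<close>, and
  \<open>1 + \<phi> (N w)\<close> is their number.  At \<open>w = 0\<close> the function vanishes.
\<close>
lemma sum_polar:
  fixes h :: "'b \<Rightarrow> complex"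
  assumes "h 0 = 0"
  shows "(\<Sum>j\<in>UNIV. \<Sum>u | N u = 1. h (\<iota> j * u)) = (\<Sum>w\<in>UNIV. (1 + \<phi> (N w)) * h w)"
proof -
  have "(\<Sum>j\<in>UNIV. \<Sum>u | N u = 1. h (\<iota> j * u)) = (\<Sum>j\<in>UNIV. \<Sum>w | w \<in> UNIV \<and> N w = j ^ 2. h w)"
    by (simp add: sum_over_norm_square[where h = h, OF assms])
  also have "\<dots> = (\<Sum>w\<in>UNIV. \<Sum>j | j \<in> UNIV \<and> N w = j ^ 2. h w)"
    by (rule sum.swap_restrict) auto
  also have "\<dots> = (\<Sum>w\<in>UNIV. of_nat (card {j. j ^ 2 = N w}) * h w)"
    by (simp add: eq_commute)
  finally show ?thesis
    by (simp only: of_nat_card_square_roots[OF odd_card[OF card_base_mod_4]])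
qed

text \<open>
  Clearing the denominator, \<open>(a - im) - j (a + im) = a (1 - j) - (1 + j) im\<close>, whose norm is a
  sum of two squares.
\<close>
lemma N_one_minus_unit_param:
  "N (1 - \<iota> j * unit_param a) = (a ^ 2 * (1 - j) ^ 2 + (1 + j) ^ 2) / (a ^ 2 + 1)"
proof -
  have "1 - \<iota> j * unit_param a = (\<iota> (a * (1 - j)) + \<iota> (- (1 + j)) * im) / (\<iota> a - im)"
    using emb_minus_im_nonzero[of a]
    by (simp add: unit_param_def emb_mult emb_diff emb_add emb_minus diff_divide_eq_iff) (simp add: algebra_simps)
  then have "N (1 - \<iota> j * unit_param a) = ((a * (1 - j)) ^ 2 + (- (1 + j)) ^ 2) / (a ^ 2 + 1)"
    by (simp only: N_divide N_cartesian N_emb_minus_im)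
  then show ?thesis
    by (simp only: power_mult_distrib power2_minus)
qed

text \<open>
  Factor \<open>1 - j^2 u^2 = (1 - j u)(1 + j u)\<close>.  The two denominators \<open>a^2 + 1\<close> multiply to a square
  and disappear under \<open>\<phi>\<close>.
\<close>
lemma phi_N_one_minus_square:
  "\<phi> (N (1 - (\<iota> j * unit_param a) ^ 2)) =
     \<phi> (a ^ 2 * (1 - j) ^ 2 + (1 + j) ^ 2) * \<phi> (a ^ 2 * (1 + j) ^ 2 + (1 - j) ^ 2)"
proof -
  have "1 - (\<iota> j * unit_param a) ^ 2 = (1 - \<iota> j * unit_param a) * (1 - \<iota> (- j) * unit_param a)"
    by (simp add: emb_minus power2_eq_square algebra_simps)
  then have "\<phi> (N (1 - (\<iota> j * unit_param a) ^ 2)) =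
      (\<phi> (a ^ 2 + 1) * \<phi> (a ^ 2 + 1)) *
      (\<phi> (a ^ 2 * (1 - j) ^ 2 + (1 + j) ^ 2) * \<phi> (a ^ 2 * (1 + j) ^ 2 + (1 - j) ^ 2))"
    by (simp only: N_mult N_one_minus_unit_param divide_inverse phi_mult phi_inverse) simp
  then show ?thesis
    by (simp only: quadratic_char_mult_self[OF square_plus_1_nonzero] mult_1)
qed

end

section \<open>A character of order eight\<close>

locale octic_character = quadratic_extension +
  fixes M8 :: "'b \<Rightarrow> complex"
  assumes M8: "mult_character M8" and order_M8: "char_order M8 = 8"
begin

lemma M8_mult: "M8 (x * y) = M8 x * M8 y"
  and M8_0 [simp]: "M8 0 = 0" and M8_1 [simp]: "M8 1 = 1"
  using M8 by (auto simp: mult_character_def)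

lemma M8_power2: "M8 (x ^ 2) = M8 x ^ 2"
  by (simp add: M8_mult power2_eq_square)

lemma M8_power_8: "x \<noteq> 0 \<Longrightarrow> M8 x ^ 8 = 1"
  using char_order_power(1)[OF M8] order_M8 by simp

text \<open>
  Both sides are 1 at nonzero squares.  As the order of \<open>M8\<close> is 8, \<open>M8^4\<close> takes the value \<open>-1\<close> at
  some \<open>x\<close>, necessarily a nonsquare; for any other nonsquare \<open>z\<close> the product \<open>z x\<close> is a square, so
  \<open>M8^4\<close> is \<open>-1\<close> at \<open>z\<close> too.
\<close>
lemma M8_power_4: "M8 z ^ 4 = \<phi> (N z)"
proof -
  have square: "M8 z ^ 4 = 1" if z: "z \<noteq> 0" "N z = c ^ 2" for z c
  proof -
    obtain s where s: "z = s ^ 2"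
      using square_if_norm_square[OF z(2)] by blast
    then have "M8 z ^ 4 = M8 s ^ 8"
      by (simp add: M8_power2 flip: power_mult)
    then show ?thesis
      using z s M8_power_8[of s] by auto
  qed
  obtain x where x: "x \<noteq> 0" "M8 x ^ 4 \<noteq> 1"
    using char_order_power(2)[OF M8, of 4] order_M8 by auto
  have "(M8 x ^ 4) ^ 2 = 1"
    using M8_power_8[OF x(1)] by (simp flip: power_mult)
  then have "M8 x ^ 4 = 1 \<or> M8 x ^ 4 = - 1"
    by (simp only: power2_eq_1_iff)
  then have x4: "M8 x ^ 4 = - 1"
    using x by blast
  have "\<phi> (N x) = - 1"
    using square x by (auto simp: quadratic_char_def)
  show ?thesis
  proof (cases "z = 0 \<or> (\<exists>c. N z = c ^ 2)")
    case True
    then show ?thesis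
      using square by (auto simp: quadratic_char_def)
  next
    case False
    then have z: "z \<noteq> 0" "\<phi> (N z) = - 1"
      by (auto simp: quadratic_char_def)
    then have "\<phi> (N (z * x)) = 1"
      using \<open>\<phi> (N x) = - 1\<close> by (simp add: N_mult phi_mult)
    then obtain c where "N (z * x) = c ^ 2"
      by (auto simp: quadratic_char_def split: if_splits)
    then have "M8 (z * x) ^ 4 = 1"
      using square z x by (metis mult_eq_0_iff)
    then have "- (M8 z ^ 4) = 1"
      by (simp add: M8_mult power_mult_distrib x4)
    then show ?thesis
      using z by (metis minus_minus)
  qed
qed

text \<open>
  Since \<open>q \<equiv> 3 (mod 4)\<close>, the exponent satisfies \<open>2 q \<equiv> 4 + 2 (mod 8)\<close>, and \<open>M8^4\<close> is \<open>\<phi> \<circ> N\<close>.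
\<close>
lemma M8_conj_power2: "M8 (conjugate w) ^ 2 = \<phi> (N w) * M8 w ^ 2"
proof (cases "w = 0")
  case False
  define m where "m = CARD('a) div 4"
  have m: "CARD('a) = 4 * m + 3"
    using card_base_mod_4 unfolding m_def by presburger
  have "M8 (conjugate w) ^ 2 = M8 w ^ (CARD('a) * 2)"
    using mult_character_power[OF M8, of "CARD('a)" w] False by (simp add: conjugate_def power_mult)
  also have "CARD('a) * 2 = 8 * m + 4 + 2"
    by (simp add: m)
  also have "M8 w ^ (8 * m + 4 + 2) = \<phi> (N w) * M8 w ^ 2"
    by (simp only: power_add power_mult M8_power_8[OF False] M8_power_4 power_one mult_1)
  finally show ?thesis .
qed simp

text \<open>
  Up to sign, \<open>j\<close> is a square \<open>y^2\<close> of the base field, and \<open>M8 (y^2)^2 = M8 y^4 = \<phi> (y^2) = 1\<close>; the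
  sign is harmless because \<open>-1 = im^2\<close> and \<open>N im = 1\<close>.
\<close>
lemma M8_emb_power2: "j \<noteq> 0 \<Longrightarrow> M8 (\<iota> j) ^ 2 = 1"
proof -
  assume j: "j \<noteq> 0"
  obtain y where y: "j = y ^ 2 \<or> j = - (y ^ 2)"
    by (rule square_or_minus_square[OF card_base_mod_4])
  then have "y \<noteq> 0"
    using j by auto
  have 4: "M8 (z ^ 2) ^ 2 = M8 z ^ 4" for z
    by (simp add: M8_power2 flip: power_mult)
  have "M8 (\<iota> y ^ 2) ^ 2 = 1"
    using quadratic_char_square[OF \<open>y \<noteq> 0\<close>] by (simp only: 4 M8_power_4 N_emb)
  moreover have "M8 (- 1) ^ 2 = 1"
    using N_emb_plus_im[of 0] 4[of im] by (simp add: im_square M8_power_4)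
  moreover have "\<iota> j = \<iota> y ^ 2 \<or> \<iota> j = - 1 * \<iota> y ^ 2"
    using y by (auto simp: emb_minus emb_power)
  ultimately show ?thesis
    by (metis M8_mult mult_1 power_mult_distrib)
qed

text \<open>
  By \<open>unit_param_eq\<close> the left side is \<open>M8^4\<close> at \<open>a + im\<close>, an element of norm \<open>a^2 + 1\<close>, divided by
  the trivial value of \<open>M8^2\<close> on the base field.
\<close>
lemma M8_unit_param_power2: "M8 (unit_param a) ^ 2 = \<phi> (a ^ 2 + 1)"
proof -
  have "unit_param a * \<iota> (a ^ 2 + 1) = (\<iota> a + im) ^ 2"
    using square_plus_1_nonzero[of a] by (simp add: unit_param_eq)
  then have "M8 (unit_param a) ^ 2 * M8 (\<iota> (a ^ 2 + 1)) ^ 2 = (M8 (\<iota> a + im) ^ 2) ^ 2"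
    by (simp only: M8_mult[symmetric] M8_power2[symmetric] power_mult_distrib[symmetric])
  also have "\<dots> = M8 (\<iota> a + im) ^ 4"
    by (simp flip: power_mult)
  finally show ?thesis
    using M8_emb_power2[OF square_plus_1_nonzero[of a]] by (simp add: M8_power_4 N_emb_plus_im)
qed

section \<open>The two Jacobi sums as one sum over the extension\<close>

context
  fixes \<nu> :: "'a \<Rightarrow> complex"
  assumes \<nu>: "mult_character \<nu>"
begin

definition summand :: "'b \<Rightarrow> complex" where
  "summand w = \<nu> (N w) ^ 2 * M8 w ^ 2 * \<phi> (N (1 - w ^ 2))"

lemma nu_mult: "\<nu> (x * y) = \<nu> x * \<nu> y"
  using \<nu> by (auto simp: mult_character_def)

text \<open>
  \<open>M8^5\<close> is \<open>M8\<close> times the quadratic character, so the two Jacobi sums combine to a sum weighted by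
  the number of square roots of \<open>z\<close>; substitute \<open>z = w^2\<close>.
\<close>
lemma jacobi_sums_eq_sum_summand:
  "jacobi_sum (\<lambda>z. \<nu> (N z) * M8 z) (\<lambda>z. \<phi> (N z)) + jacobi_sum (\<lambda>z. \<nu> (N z) * M8 z ^ 5) (\<lambda>z. \<phi> (N z))
   = (\<Sum>w\<in>UNIV. summand w)"
proof -
  have "M8 z ^ 5 = quadratic_char z * M8 z" for z
    using power_add[of "M8 z" 4 1] by (simp add: quadratic_char_ext M8_power_4)
  then have "jacobi_sum (\<lambda>z. \<nu> (N z) * M8 z) (\<lambda>z. \<phi> (N z)) + jacobi_sum (\<lambda>z. \<nu> (N z) * M8 z ^ 5) (\<lambda>z. \<phi> (N z))
     = (\<Sum>z\<in>UNIV. (1 + quadratic_char z) * (\<nu> (N z) * M8 z * \<phi> (N (1 - z))))"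
    by (simp add: jacobi_sum_def algebra_simps flip: sum.distrib)
  also have "\<dots> = (\<Sum>w\<in>UNIV. \<nu> (N (w ^ 2)) * M8 (w ^ 2) * \<phi> (N (1 - w ^ 2)))"
    by (rule sum_over_squares[OF odd_card_ext, symmetric])
  also have "\<dots> = (\<Sum>w\<in>UNIV. summand w)"
    by (simp only: summand_def N_power2 M8_power2) (simp add: nu_mult power2_eq_square)
  finally show ?thesis .
qed

text \<open>
  This is why the elements whose norm is a nonsquare contribute nothing in total.
\<close>
lemma summand_conj: "summand (conjugate w) = \<phi> (N w) * summand w"
proof -
  have "1 - conjugate w ^ 2 = conjugate (1 - w ^ 2)"
    by (simp add: conj_diff conj_mult power2_eq_square)
  then show ?thesis
    by (simp add: summand_def N_conj M8_conj_power2)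
qed

lemma sum_phi_N_summand: "(\<Sum>w\<in>UNIV. \<phi> (N w) * summand w) = (\<Sum>w\<in>UNIV. summand w)"
  unfolding summand_conj[symmetric]
  by (rule sum.reindex_bij_witness[where i = conjugate and j = conjugate]) auto

lemma summand_emb:
  "j \<noteq> 0 \<Longrightarrow> summand (\<iota> j) = \<nu> j ^ 4 * \<phi> ((1 - j) ^ 2 * (1 + j) ^ 2)"
proof -
  assume j: "j \<noteq> 0"
  have "1 - \<iota> j ^ 2 = \<iota> ((1 - j) * (1 + j))"
    by (simp add: emb_mult emb_add emb_diff algebra_simps power2_eq_square)
  then have "N (1 - \<iota> j ^ 2) = (1 - j) ^ 2 * (1 + j) ^ 2"
    by (simp only: N_emb power_mult_distrib)
  then show ?thesis
    using M8_emb_power2[OF j]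
    by (simp add: summand_def N_emb nu_mult power2_eq_square power4_eq_xxxx)
qed

lemma summand_emb_unit_param:
  "j \<noteq> 0 \<Longrightarrow> summand (\<iota> j * unit_param a) = \<nu> j ^ 4 * (\<phi> (a ^ 2 + 1)
     * \<phi> (a ^ 2 * (1 - j) ^ 2 + (1 + j) ^ 2) * \<phi> (a ^ 2 * (1 + j) ^ 2 + (1 - j) ^ 2))"
proof -
  assume j: "j \<noteq> 0"
  have "N (unit_param a) = 1"
    using range_unit_param by auto
  then have "\<nu> (N (\<iota> j * unit_param a)) ^ 2 = \<nu> j ^ 4"
    by (simp add: N_mult N_emb nu_mult power2_eq_square power4_eq_xxxx)
  moreover have "M8 (\<iota> j * unit_param a) ^ 2 = \<phi> (a ^ 2 + 1)"
    by (simp add: M8_mult power_mult_distrib M8_emb_power2[OF j] M8_unit_param_power2)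
  ultimately show ?thesis
    by (simp only: summand_def phi_N_one_minus_square mult.assoc)
qed

lemma sum_summand_polar:
  assumes "j \<noteq> 0"
  shows "(\<Sum>u | N u = 1. summand (\<iota> j * u))
    = 2 * (\<nu> j ^ 4 * \<phi> j * legendre_sum ((1 - j) ^ 2) ((1 + j) ^ 2))"
proof -
  have "(\<Sum>u | N u = 1. summand (\<iota> j * u)) = \<nu> j ^ 4 *
      (\<phi> ((1 - j) ^ 2 * (1 + j) ^ 2) + (\<Sum>a\<in>UNIV. \<phi> (a ^ 2 + 1)
        * \<phi> (a ^ 2 * (1 - j) ^ 2 + (1 + j) ^ 2) * \<phi> (a ^ 2 * (1 + j) ^ 2 + (1 - j) ^ 2)))"
    unfolding sum_norm_one
    by (simp only: mult_1_right summand_emb[OF assms] summand_emb_unit_param[OF assms]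
        distrib_left sum_distrib_left)
  then show ?thesis
    by (simp only: sum_over_line_eq_legendre_sum[OF card_base_mod_4 assms]) simp
qed

text \<open>
  By \<open>sum_phi_N_summand\<close>, inserting the weight \<open>1 + \<phi> (N w)\<close> only doubles the sum, and with this
  weight \<open>sum_polar\<close> splits it according to \<open>j\<close>.
\<close>
lemma sum_legendre_sum_eq_jacobi_sums:
  "(\<Sum>j\<in>UNIV - {0}. \<nu> j ^ 4 * \<phi> j * legendre_sum ((1 - j) ^ 2) ((1 + j) ^ 2))
   = jacobi_sum (\<lambda>z. \<nu> (N z) * M8 z) (\<lambda>z. \<phi> (N z)) + jacobi_sum (\<lambda>z. \<nu> (N z) * M8 z ^ 5) (\<lambda>z. \<phi> (N z))"
proof -
  have 0: "summand 0 = 0"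
    by (simp add: summand_def)
  have "2 * (\<Sum>w\<in>UNIV. summand w) = (\<Sum>w\<in>UNIV. (1 + \<phi> (N w)) * summand w)"
    by (simp add: distrib_right sum.distrib sum_phi_N_summand)
  also have "\<dots> = (\<Sum>j\<in>UNIV. \<Sum>u | N u = 1. summand (\<iota> j * u))"
    by (rule sum_polar[where h = summand, OF 0, symmetric])
  also have "\<dots> = (\<Sum>j\<in>UNIV - {0}. \<Sum>u | N u = 1. summand (\<iota> j * u))"
    by (simp add: sum_UNIV_split_0 0)
  also have "\<dots> = 2 * (\<Sum>j\<in>UNIV - {0}. \<nu> j ^ 4 * \<phi> j * legendre_sum ((1 - j) ^ 2) ((1 + j) ^ 2))"
    by (simp add: sum_summand_polar sum_distrib_left)
  finally show ?thesis
    by (simp add: jacobi_sums_eq_sum_summand)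
qed

end

end

theorem theorem5p4:
  fixes \<iota> :: "'a::{field,finite} \<Rightarrow> 'b::{field,finite}"
    and \<nu> :: "'a \<Rightarrow> complex"
    and M8 :: "'b \<Rightarrow> complex"
    and p k q :: nat
  assumes "prime p" and "odd p" and "0 < k" and "q = p ^ k"
    and "q mod 4 = 3"
    and "CARD('a) = q" and "CARD('b) = q ^ 2"
    and "field_embedding \<iota>"
    and "mult_character M8" and "char_order M8 = 8"
    and "mult_character \<nu>"
  shows "(\<Sum>j\<in>UNIV - {0::'a}. \<Sum>x\<in>UNIV - {0::'a}.
            (quadratic_char j * \<nu> j ^ 4) * quadratic_char x * quadratic_char (1 - x)
            * quadratic_char (x * (j + 1) ^ 2 + (j - 1) ^ 2))
       = jacobi_sum (\<lambda>z. \<nu> (quad_norm \<iota> z) * M8 z) (\<lambda>z. quadratic_char (quad_norm \<iota> z))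
         + jacobi_sum (\<lambda>z. \<nu> (quad_norm \<iota> z) * M8 z ^ 5) (\<lambda>z. quadratic_char (quad_norm \<iota> z))"
proof -
  interpret octic_character \<iota> p k M8
    by unfold_locales (use assms in auto)
  have "(\<Sum>x\<in>UNIV - {0}. (\<phi> j * \<nu> j ^ 4) * \<phi> x * \<phi> (1 - x) * \<phi> (x * (j + 1) ^ 2 + (j - 1) ^ 2))
      = \<nu> j ^ 4 * \<phi> j * legendre_sum ((1 - j) ^ 2) ((1 + j) ^ 2)" for j
    by (simp add: legendre_sum_def sum_UNIV_split_0 sum_distrib_left mult_ac
        power2_commute[of 1 j] add.commute[of 1 j])
  then show ?thesis
    using sum_legendre_sum_eq_jacobi_sums[OF assms(11)] by simp
qed

end
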